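(* Let $E=(-2,2)\setminus\{0\}$ with $d(x,y)=|x-y|$, let $(\theta_n)_{n\ge1}$ be i.i.d. with $\mathbb{P}(\theta_1=1)=\mathbb{P}(\theta_1=-1)=\frac12$, let $X_{n+1}=\frac12X_n+\theta_{n+1}$ be the corresponding Markov chain on $E$, and let $p(x)=\frac{|x|}2$ for $x\in E$. For $n\ge1$, let $P_nf(x)=\mathbb{E}_x[p(X_0)p(X_1)\cdots p(X_{n-1})f(X_n)]$. Then for all $x,y\in E$ and all $n\ge1$, $$\mathcal{W}_d\left(\frac{\delta_xP_n}{\delta_xP_n\mathbf 1},\frac{\delta_yP_n}{\delta_yP_n\mathbf 1}\right)\ge\frac12|x-y|.$$
   Context: $\mathbb{E}_x$ is the expectation for the chain with $X_0=x$; $\delta_xP_n$ is the measure $f\mapsto P_nf(x)$ and $\mathbf 1$ the constant function equal to $1$. $\mathcal{W}_d(\mu,\nu)=\inf_\pi\iint d(x,y)\,\pi(dx,dy)$ (infimum over couplings $\pi$ of $\mu,\nu$) is the $L^1$-Wasserstein distance. *)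

theory Defs
  imports "HOL-Probability.Probability"
begin

definition couplings :: "'a measure \<Rightarrow> 'b measure \<Rightarrow> ('a \<times> 'b) measure set" where
  "couplings \<mu> \<nu> =
     {\<pi>. sets \<pi> = sets (\<mu> \<Otimes>\<^sub>M \<nu>) \<and> distr \<pi> \<mu> fst = \<mu> \<and> distr \<pi> \<nu> snd = \<nu>}"

(* Valued in ennreal, so that the infimum and the integrals need no side conditions. *)
definition wasserstein :: "('a \<Rightarrow> 'a \<Rightarrow> real) \<Rightarrow> 'a measure \<Rightarrow> 'a measure \<Rightarrow> ennreal" where
  "wasserstein d \<mu> \<nu> = (INF \<pi>\<in>couplings \<mu> \<nu>. \<integral>\<^sup>+(x, y). ennreal (d x y) \<partial>\<pi>)"

definition state_space :: "real set" where
  "state_space = {-2<..<2} - {0}"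

primrec chain :: "(nat \<Rightarrow> 'w \<Rightarrow> real) \<Rightarrow> real \<Rightarrow> nat \<Rightarrow> 'w \<Rightarrow> real" where
  "chain \<theta> x 0 = (\<lambda>\<omega>. x)"
| "chain \<theta> x (Suc n) = (\<lambda>\<omega>. 1/2 * chain \<theta> x n \<omega> + \<theta> (Suc n) \<omega>)"

definition surv :: "real \<Rightarrow> real" where
  "surv x = \<bar>x\<bar> / 2"

(* P_n f (x); the expectation for the chain started at x is taken over the noise space M. *)
definition Pn :: "'w measure \<Rightarrow> (nat \<Rightarrow> 'w \<Rightarrow> real) \<Rightarrow> nat \<Rightarrow> (real \<Rightarrow> real) \<Rightarrow> real \<Rightarrow> real" where
  "Pn M \<theta> n f x =
     (\<integral>\<omega>. (\<Prod>k<n. surv (chain \<theta> x k \<omega>)) * f (chain \<theta> x n \<omega>) \<partial>M)"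

(* delta_x P_n as a Borel measure on the state space. It is given by its values on sets rather
   than as a push-forward because the noise is only almost surely in {-1, 1}, so the chain may
   leave the state space on a null set. *)
definition deltaP :: "'w measure \<Rightarrow> (nat \<Rightarrow> 'w \<Rightarrow> real) \<Rightarrow> nat \<Rightarrow> real \<Rightarrow> real measure" where
  "deltaP M \<theta> n x =
     measure_of state_space (sets (restrict_space borel state_space))
       (\<lambda>A. ennreal (Pn M \<theta> n (indicator A) x))"

definition normalized_deltaP ::
    "'w measure \<Rightarrow> (nat \<Rightarrow> 'w \<Rightarrow> real) \<Rightarrow> nat \<Rightarrow> real \<Rightarrow> real measure" where
  "normalized_deltaP M \<theta> n x =
     scale_measure (ennreal (1 / Pn M \<theta> n (\<lambda>_. 1) x)) (deltaP M \<theta> n x)"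

end

theory Submission
  imports Defs
begin

text \<open>
  On the state space, \<open>\<bar>X\<^sub>k\<bar> = \<theta>\<^sub>k X\<^sub>k\<close> almost surely for \<open>k \<ge> 1\<close>, because \<open>\<bar>X\<^sub>k\<^sub>-\<^sub>1\<bar> / 2 < 1\<close>.
  The survival weights are therefore polynomial in the noise, and integrating out the last
  variable gives \<open>P\<^sub>n \<one> (x) = \<bar>x\<bar> / 2\<^sup>n\<close> and \<open>P\<^sub>n id (x) = x \<bar>x\<bar> / 2\<^sup>n\<^sup>+\<^sup>1\<close>: up to time
  \<open>n - 1\<close> the tilted chain is a martingale, and the untilted last step halves the mean. So the
  normalized law started at \<open>x\<close> has mean \<open>x / 2\<close>, and the Wasserstein distance is at least the
  difference of the means.
\<close>

section \<open>Bounding the Wasserstein distance by means\<close>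

lemma wasserstein_ge_mean_diff:
  fixes \<mu> \<nu> :: "real measure"
  assumes \<mu>: "integrable \<mu> (\<lambda>u. u)" and \<nu>: "integrable \<nu> (\<lambda>u. u)"
  shows "ennreal \<bar>(\<integral>u. u \<partial>\<mu>) - (\<integral>u. u \<partial>\<nu>)\<bar> \<le> wasserstein (\<lambda>u v. \<bar>u - v\<bar>) \<mu> \<nu>"
  unfolding wasserstein_def
proof (rule INF_greatest)
  fix \<pi> assume "\<pi> \<in> couplings \<mu> \<nu>"
  then have sets_\<pi>: "sets \<pi> = sets (\<mu> \<Otimes>\<^sub>M \<nu>)"
    and fst_\<pi>: "distr \<pi> \<mu> fst = \<mu>" and snd_\<pi>: "distr \<pi> \<nu> snd = \<nu>"
    by (auto simp: couplings_def)
  have fst_meas: "fst \<in> measurable \<pi> \<mu>" and snd_meas: "snd \<in> measurable \<pi> \<nu>"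
    by (simp_all add: measurable_cong_sets[OF sets_\<pi> refl])
  have int_fst: "integrable \<pi> (\<lambda>z. fst z)"
    using integrable_distr_eq[OF fst_meas, of "\<lambda>u. u"] \<mu> fst_\<pi> by auto
  have int_snd: "integrable \<pi> (\<lambda>z. snd z)"
    using integrable_distr_eq[OF snd_meas, of "\<lambda>u. u"] \<nu> snd_\<pi> by auto
  have "(\<integral>u. u \<partial>\<mu>) = (\<integral>z. fst z \<partial>\<pi>)"
    using integral_distr[OF fst_meas, of "\<lambda>u. u"] \<mu> fst_\<pi> by auto
  moreover have "(\<integral>u. u \<partial>\<nu>) = (\<integral>z. snd z \<partial>\<pi>)"
    using integral_distr[OF snd_meas, of "\<lambda>u. u"] \<nu> snd_\<pi> by auto
  \<comment> \<open>Both means are now integrals over the same coupling. What follows is the easy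
    half of Kantorovich duality for the 1-Lipschitz test function
    \<open>\<lambda>u. u\<close>.\<close>
  ultimately have "\<bar>(\<integral>u. u \<partial>\<mu>) - (\<integral>u. u \<partial>\<nu>)\<bar> = \<bar>\<integral>z. fst z - snd z \<partial>\<pi>\<bar>"
    using int_fst int_snd by simp
  also have "\<dots> \<le> (\<integral>z. \<bar>fst z - snd z\<bar> \<partial>\<pi>)"
    by (rule integral_abs_bound)
  finally have "ennreal \<bar>(\<integral>u. u \<partial>\<mu>) - (\<integral>u. u \<partial>\<nu>)\<bar> \<le> ennreal (\<integral>z. \<bar>fst z - snd z\<bar> \<partial>\<pi>)"
    by (rule ennreal_leI)
  also have "\<dots> = (\<integral>\<^sup>+z. ennreal \<bar>fst z - snd z\<bar> \<partial>\<pi>)"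
    using int_fst int_snd by (intro nn_integral_eq_integral[symmetric]) auto
  finally show "ennreal \<bar>(\<integral>u. u \<partial>\<mu>) - (\<integral>u. u \<partial>\<nu>)\<bar> \<le> (\<integral>\<^sup>+(u, v). ennreal \<bar>u - v\<bar> \<partial>\<pi>)"
    by (simp add: case_prod_unfold)
qed

text \<open>Brings the normalization into the form that \<open>has_bochner_integral_density\<close>
  handles.\<close>

lemma scale_measure_eq_density: "scale_measure r N = density N (\<lambda>_. r)"
  by (rule measure_eqI) (simp_all add: emeasure_density nn_integral_cmult_indicator)

section \<open>The weight and the chain as functionals of the noise\<close>

definition weight :: "(nat \<Rightarrow> 'w \<Rightarrow> real) \<Rightarrow> real \<Rightarrow> nat \<Rightarrow> 'w \<Rightarrow> real" where
  "weight \<theta> x n \<omega> = (\<Prod>k<n. surv (chain \<theta> x k \<omega>))"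

lemma weight_Suc: "weight \<theta> x (Suc n) \<omega> = weight \<theta> x n \<omega> * surv (chain \<theta> x n \<omega>)"
  by (simp add: weight_def)

lemma weight_nonneg: "0 \<le> weight \<theta> x n \<omega>"
  by (simp add: weight_def surv_def prod_nonneg)

lemma Pn_eq_weight: "Pn M \<theta> n f x = (\<integral>\<omega>. weight \<theta> x n \<omega> * f (chain \<theta> x n \<omega>) \<partial>M)"
  by (simp add: Pn_def weight_def)

lemma state_space_borel [measurable]: "state_space \<in> sets borel"
  by (simp add: state_space_def)

lemma surv_borel [measurable]: "surv \<in> borel_measurable borel"
  unfolding surv_def[abs_def] by measurable

text \<open>The measure \<open>N\<close> is arbitrary because two instances occur: the noise space,
  and a finite product space with its coordinate maps. The latter has only the coordinates
  \<open>1..n\<close>, hence the restricted hypothesis.\<close>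

lemma chain_measurable:
  assumes "\<And>k. k \<in> {1..n} \<Longrightarrow> \<theta> k \<in> borel_measurable N"
  shows "chain \<theta> x n \<in> borel_measurable N"
  using assms
proof (induction n)
  case (Suc n)
  have [measurable]: "chain \<theta> x n \<in> borel_measurable N" "\<theta> (Suc n) \<in> borel_measurable N"
    using Suc by auto
  show ?case by simp
qed simp

text \<open>The last factor is taken at time \<open>n - 1\<close>, so the sign with index
  \<open>n\<close> does not enter.\<close>

lemma weight_measurable:
  assumes "\<And>k. k \<in> {1..<n} \<Longrightarrow> \<theta> k \<in> borel_measurable N"
  shows "weight \<theta> x n \<in> borel_measurable N"
  unfolding weight_def[abs_def]
  using assms by (intro borel_measurable_prod measurable_compose[OF chain_measurable surv_borel]) auto

text \<open>Exhibits the chain as a fixed function of the finite noise vector, the form in which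
  independence of blocks of signs can be composed with it.\<close>

lemma chain_restrict:
  "n \<le> m \<Longrightarrow> chain \<theta> x n \<omega> = chain (\<lambda>k \<eta>. \<eta> k) x n (restrict (\<lambda>k. \<theta> k \<omega>) {1..m})"
  by (induction n) auto

lemma weight_restrict:
  "n \<le> Suc m \<Longrightarrow> weight \<theta> x n \<omega> = weight (\<lambda>k \<eta>. \<eta> k) x n (restrict (\<lambda>k. \<theta> k \<omega>) {1..m})"
  unfolding weight_def by (intro prod.cong refl arg_cong[where f=surv] chain_restrict) auto

text \<open>A state \<open>u\<close> has |u/2| < 1, so adding a sign to u/2 stays inside (-2,2) and
  cannot hit 0.\<close>

lemma chain_in_state_space:
  assumes "x \<in> state_space" and "\<And>k. k \<ge> 1 \<Longrightarrow> \<theta> k \<omega> = 1 \<or> \<theta> k \<omega> = -1"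
  shows "chain \<theta> x n \<omega> \<in> state_space"
proof (induction n)
  case (Suc n)
  show ?case
    using Suc assms(2)[of "Suc n"] by (auto simp: state_space_def)
qed (simp add: assms)

lemma surv_in_unit: "u \<in> state_space \<Longrightarrow> 0 \<le> surv u \<and> surv u \<le> 1"
  by (auto simp: surv_def state_space_def)

text \<open>The sign \<open>t\<close> dominates u/2, so the absolute value is t * (u/2 + t), and t *
  t = 1. This makes the survival probability affine in the new sign.\<close>

lemma abs_step:
  assumes "u \<in> state_space" and "t = 1 \<or> t = -1"
  shows "\<bar>1/2 * u + t\<bar> = t * u / 2 + 1"
  using assms by (auto simp: state_space_def)

section \<open>Fair signs and almost sure bounds\<close>

locale fair_signs = prob_space M for M :: "'w measure" +
  fixes \<theta> :: "nat \<Rightarrow> 'w \<Rightarrow> real"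
  assumes indep: "indep_vars (\<lambda>_. borel) \<theta> {1..}"
    and prob_plus: "k \<ge> 1 \<Longrightarrow> prob {\<omega> \<in> space M. \<theta> k \<omega> = 1} = 1/2"
    and prob_minus: "k \<ge> 1 \<Longrightarrow> prob {\<omega> \<in> space M. \<theta> k \<omega> = -1} = 1/2"
begin

lemma \<theta>_measurable: "k \<ge> 1 \<Longrightarrow> \<theta> k \<in> borel_measurable M"
  using indep by (auto simp: indep_vars_def)

lemma AE_sign:
  assumes "k \<ge> 1"
  shows "AE \<omega> in M. \<theta> k \<omega> = 1 \<or> \<theta> k \<omega> = -1"
proof -
  note [measurable] = \<theta>_measurable[OF assms]
  have "prob ({\<omega> \<in> space M. \<theta> k \<omega> = 1} \<union> {\<omega> \<in> space M. \<theta> k \<omega> = -1}) = 1/2 + 1/2"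
    unfolding prob_plus[OF assms, symmetric]
    by (subst finite_measure_Union) (auto simp: prob_plus[OF assms] prob_minus[OF assms])
  also have "{\<omega> \<in> space M. \<theta> k \<omega> = 1} \<union> {\<omega> \<in> space M. \<theta> k \<omega> = -1}
      = {\<omega> \<in> space M. \<theta> k \<omega> = 1 \<or> \<theta> k \<omega> = -1}"
    by auto
  finally have "prob {\<omega> \<in> space M. \<theta> k \<omega> = 1 \<or> \<theta> k \<omega> = -1} = 1"
    by simp
  then show ?thesis
    by (subst prob_Collect_eq_1[symmetric]) simp_all
qed

lemma AE_signs: "AE \<omega> in M. \<forall>k\<ge>1. \<theta> k \<omega> = 1 \<or> \<theta> k \<omega> = -1"
  using AE_sign by (auto simp: AE_all_countable)

lemma integrable_sign:
  assumes "k \<ge> 1"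
  shows "integrable M (\<theta> k)"
  using AE_sign[OF assms] \<theta>_measurable[OF assms]
  by (intro integrable_const_bound[where B=1]) auto

lemma expectation_sign:
  assumes "k \<ge> 1"
  shows "expectation (\<theta> k) = 0"
proof -
  note [measurable] = \<theta>_measurable[OF assms]
  \<comment> \<open>The hypotheses give only the probabilities of two events, so the sign is
    replaced almost everywhere by the difference of their indicators.\<close>
  have "expectation (\<theta> k) = expectation (\<lambda>\<omega>. indicator {\<omega> \<in> space M. \<theta> k \<omega> = 1} \<omega>
      - indicator {\<omega> \<in> space M. \<theta> k \<omega> = -1} \<omega>)"
    using AE_sign[OF assms] by (intro integral_cong_AE) (auto simp: indicator_def)
  also have "\<dots> = 0"
    by (subst Bochner_Integration.integral_diff)
      (auto simp: prob_plus[OF assms] prob_minus[OF assms] less_top[symmetric])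
  finally show ?thesis .
qed

lemma chain_borel [measurable]: "chain \<theta> x n \<in> borel_measurable M"
  by (rule chain_measurable) (simp add: \<theta>_measurable)

lemma weight_borel [measurable]: "weight \<theta> x n \<in> borel_measurable M"
  by (rule weight_measurable) (simp add: \<theta>_measurable)

lemma AE_chain: "x \<in> state_space \<Longrightarrow> AE \<omega> in M. \<forall>n. chain \<theta> x n \<omega> \<in> state_space"
  using AE_signs by eventually_elim (blast intro: chain_in_state_space)

text \<open>Almost surely the weight lies in [0,1] and the chain in the state space, where
  \<open>g\<close> is bounded. The two times are separate because both \<open>m = n\<close> and
  \<open>m = Suc n\<close> are needed.\<close>

lemma integrable_weight:
  assumes x: "x \<in> state_space" and g [measurable]: "g \<in> borel_measurable borel"
    and bound: "\<And>u. u \<in> state_space \<Longrightarrow> \<bar>g u\<bar> \<le> B"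
  shows "integrable M (\<lambda>\<omega>. weight \<theta> x m \<omega> * g (chain \<theta> x n \<omega>))"
proof (rule integrable_const_bound[where B=B])
  show "AE \<omega> in M. norm (weight \<theta> x m \<omega> * g (chain \<theta> x n \<omega>)) \<le> B"
    using AE_chain[OF x]
  proof eventually_elim
    case (elim \<omega>)
    have "weight \<theta> x m \<omega> \<le> 1"
      unfolding weight_def using elim surv_in_unit by (intro prod_le_1) auto
    moreover have "\<bar>g (chain \<theta> x n \<omega>)\<bar> \<le> B"
      using elim bound by auto
    ultimately have "weight \<theta> x m \<omega> * \<bar>g (chain \<theta> x n \<omega>)\<bar> \<le> 1 * B"
      by (intro mult_mono) auto
    then show ?case
      by (simp add: abs_mult weight_nonneg)
  qed
qed measurable

section \<open>Integrating out the newest sign\<close>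

lemma indep_past_sign:
  assumes g: "g \<in> borel_measurable borel"
  shows "indep_var borel (\<lambda>\<omega>. weight \<theta> x (Suc n) \<omega> * g (chain \<theta> x n \<omega>)) borel (\<theta> (Suc n))"
proof -
  \<comment> \<open>\<open>G\<close> is the past in coordinates. It reads only the indices
    \<open>1..n\<close>, since the last factor of the weight at \<open>Suc n\<close> is the survival
    probability at time \<open>n\<close>; this block is disjoint from
    \<open>{Suc n}\<close>.\<close>
  define G where "G \<eta> = weight (\<lambda>k \<eta>. \<eta> k) x (Suc n) \<eta> * g (chain (\<lambda>k \<eta>. \<eta> k) x n \<eta>)" for \<eta>
  let ?P = "\<lambda>A. PiM A (\<lambda>_::nat. borel :: real measure)"
  have "indep_var (?P {1..n}) (\<lambda>\<omega>. restrict (\<lambda>k. \<theta> k \<omega>) {1..n})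
      (?P {Suc n}) (\<lambda>\<omega>. restrict (\<lambda>k. \<theta> k \<omega>) {Suc n})"
    by (rule indep_var_restrict[OF indep]) auto
  moreover have "G \<in> borel_measurable (?P {1..n})"
    unfolding G_def
    by (intro borel_measurable_times weight_measurable measurable_compose[OF chain_measurable g])
      (auto intro: measurable_component_singleton)
  moreover have "(\<lambda>\<eta>. \<eta> (Suc n)) \<in> borel_measurable (?P {Suc n})"
    by (rule measurable_component_singleton) simp
  ultimately have "indep_var borel (G \<circ> (\<lambda>\<omega>. restrict (\<lambda>k. \<theta> k \<omega>) {1..n}))
      borel ((\<lambda>\<eta>. \<eta> (Suc n)) \<circ> (\<lambda>\<omega>. restrict (\<lambda>k. \<theta> k \<omega>) {Suc n}))"
    by (rule indep_var_compose)
  moreover have "G \<circ> (\<lambda>\<omega>. restrict (\<lambda>k. \<theta> k \<omega>) {1..n})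
      = (\<lambda>\<omega>. weight \<theta> x (Suc n) \<omega> * g (chain \<theta> x n \<omega>))"
    unfolding G_def comp_def
    by (simp only: weight_restrict[OF order_refl, symmetric] chain_restrict[OF order_refl, symmetric])
  moreover have "(\<lambda>\<eta>. \<eta> (Suc n)) \<circ> (\<lambda>\<omega>. restrict (\<lambda>k. \<theta> k \<omega>) {Suc n}) = \<theta> (Suc n)"
    by auto
  ultimately show ?thesis
    by simp
qed

text \<open>By independence the term linear in the new sign factorizes, and its sign factor has mean
  zero. Each moment recursion below is first made affine in the new sign to fit this
  pattern.\<close>

lemma integrate_out_sign:
  assumes x: "x \<in> state_space"
    and g: "g \<in> borel_measurable borel" "\<And>u. u \<in> state_space \<Longrightarrow> \<bar>g u\<bar> \<le> B"
    and h: "h \<in> borel_measurable borel" "\<And>u. u \<in> state_space \<Longrightarrow> \<bar>h u\<bar> \<le> C"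
  shows "expectation (\<lambda>\<omega>. weight \<theta> x (Suc n) \<omega> *
      (\<theta> (Suc n) \<omega> * g (chain \<theta> x n \<omega>) + h (chain \<theta> x n \<omega>)))
    = expectation (\<lambda>\<omega>. weight \<theta> x (Suc n) \<omega> * h (chain \<theta> x n \<omega>))"
proof -
  let ?Z = "\<lambda>\<omega>. weight \<theta> x (Suc n) \<omega> * g (chain \<theta> x n \<omega>)"
  have Z: "integrable M ?Z" and H: "integrable M (\<lambda>\<omega>. weight \<theta> x (Suc n) \<omega> * h (chain \<theta> x n \<omega>))"
    by (rule integrable_weight[OF x g] integrable_weight[OF x h]; assumption)+
  have \<theta>: "integrable M (\<theta> (Suc n))"
    by (simp add: integrable_sign)
  have "integrable M (\<lambda>\<omega>. ?Z \<omega> * \<theta> (Suc n) \<omega>)"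
    by (rule indep_var_integrable[OF indep_past_sign[OF g(1)] Z \<theta>])
  moreover have "expectation (\<lambda>\<omega>. ?Z \<omega> * \<theta> (Suc n) \<omega>) = 0"
    using indep_var_lebesgue_integral[OF indep_past_sign[OF g(1)] Z \<theta>]
    by (simp add: expectation_sign)
  moreover have "weight \<theta> x (Suc n) \<omega> * (\<theta> (Suc n) \<omega> * g (chain \<theta> x n \<omega>) + h (chain \<theta> x n \<omega>))
      = ?Z \<omega> * \<theta> (Suc n) \<omega> + weight \<theta> x (Suc n) \<omega> * h (chain \<theta> x n \<omega>)" for \<omega>
    by (simp add: algebra_simps)
  ultimately show ?thesis
    using H by simp
qed

section \<open>First two moments of the weighted chain\<close>

lemma expectation_weight:
  assumes x: "x \<in> state_space"
  shows "expectation (weight \<theta> x (Suc n)) = \<bar>x\<bar> / 2 ^ Suc n"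
proof (induction n)
  \<comment> \<open>The first factor \<open>surv x\<close> is deterministic and involves no sign, so
    the recursion starts from one factor.\<close>
  case 0
  show ?case by (simp add: weight_def[abs_def] surv_def prob_space)
next
  case (Suc n)
  have "expectation (weight \<theta> x (Suc (Suc n))) = expectation (\<lambda>\<omega>. weight \<theta> x (Suc n) \<omega> *
      (\<theta> (Suc n) \<omega> * (chain \<theta> x n \<omega> / 4) + 1/2))"
  proof (intro integral_cong_AE)
    show "AE \<omega> in M. weight \<theta> x (Suc (Suc n)) \<omega> = weight \<theta> x (Suc n) \<omega> *
        (\<theta> (Suc n) \<omega> * (chain \<theta> x n \<omega> / 4) + 1/2)"
      using AE_chain[OF x] AE_signs
    proof eventually_elim
      case (elim \<omega>)
      then have "\<theta> (Suc n) \<omega> = 1 \<or> \<theta> (Suc n) \<omega> = -1" and "chain \<theta> x n \<omega> \<in> state_space"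
        by auto
      then have "surv (chain \<theta> x (Suc n) \<omega>) = (\<theta> (Suc n) \<omega> * chain \<theta> x n \<omega> / 2 + 1) / 2"
        by (simp only: surv_def chain.simps abs_step)
      then show ?case
        by (simp only: weight_Suc[of _ _ "Suc n"]) (simp add: field_simps)
    qed
  qed (use \<theta>_measurable[of "Suc n"] in measurable)
  also have "\<dots> = expectation (\<lambda>\<omega>. weight \<theta> x (Suc n) \<omega> * (1/2))"
    by (rule integrate_out_sign[OF x, where g="\<lambda>u. u / 4" and h="\<lambda>_. 1/2" and B=1 and C=1])
      (auto simp: state_space_def)
  also have "\<dots> = \<bar>x\<bar> / 2 ^ Suc (Suc n)"
    using Suc by simp
  finally show ?case .
qed

text \<open>Divided by \<open>expectation_weight\<close>, this is the martingale property: the mean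
  tilted by survival through time \<open>n\<close> is still \<open>x\<close>.\<close>

lemma expectation_weight_chain:
  assumes x: "x \<in> state_space"
  shows "expectation (\<lambda>\<omega>. weight \<theta> x (Suc n) \<omega> * chain \<theta> x n \<omega>) = x * \<bar>x\<bar> / 2 ^ Suc n"
proof (induction n)
  case 0
  show ?case by (simp add: weight_def[abs_def] surv_def prob_space)
next
  case (Suc n)
  have "expectation (\<lambda>\<omega>. weight \<theta> x (Suc (Suc n)) \<omega> * chain \<theta> x (Suc n) \<omega>)
      = expectation (\<lambda>\<omega>. weight \<theta> x (Suc n) \<omega> *
        (\<theta> (Suc n) \<omega> * ((chain \<theta> x n \<omega>)\<^sup>2 / 8 + 1/2) + chain \<theta> x n \<omega> / 2))"
  proof (intro integral_cong_AE)
    show "AE \<omega> in M. weight \<theta> x (Suc (Suc n)) \<omega> * chain \<theta> x (Suc n) \<omega> = weight \<theta> x (Suc n) \<omega> *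
        (\<theta> (Suc n) \<omega> * ((chain \<theta> x n \<omega>)\<^sup>2 / 8 + 1/2) + chain \<theta> x n \<omega> / 2)"
      using AE_chain[OF x] AE_signs
    proof eventually_elim
      case (elim \<omega>)
      then have t: "\<theta> (Suc n) \<omega> = 1 \<or> \<theta> (Suc n) \<omega> = -1" and "chain \<theta> x n \<omega> \<in> state_space"
        by auto
      then have "surv (chain \<theta> x (Suc n) \<omega>) * chain \<theta> x (Suc n) \<omega>
          = (\<theta> (Suc n) \<omega> * chain \<theta> x n \<omega> / 2 + 1) / 2 * (1/2 * chain \<theta> x n \<omega> + \<theta> (Suc n) \<omega>)"
        by (simp only: surv_def chain.simps abs_step)
      \<comment> \<open>The product has two terms u/4, one of them carrying the squared sign, which
        is 1. Together they give u/2, so the factor 1/2 is exactly that by which the mass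
        decays.\<close>
      also have "\<dots> = \<theta> (Suc n) \<omega> * ((chain \<theta> x n \<omega>)\<^sup>2 / 8 + 1/2) + chain \<theta> x n \<omega> / 2"
        using t by (auto simp: field_simps power2_eq_square)
      finally show ?case
        by (simp only: weight_Suc[of _ _ "Suc n"] mult.assoc)
    qed
  qed (use \<theta>_measurable[of "Suc n"] in measurable)
  also have "\<dots> = expectation (\<lambda>\<omega>. weight \<theta> x (Suc n) \<omega> * (chain \<theta> x n \<omega> / 2))"
  proof (rule integrate_out_sign[OF x, where g="\<lambda>u. u\<^sup>2 / 8 + 1/2" and h="\<lambda>u. u / 2" and B=1 and C=1])
    fix u :: real assume "u \<in> state_space"
    then have "\<bar>u\<bar> \<le> 2" by (auto simp: state_space_def)
    then have "u\<^sup>2 \<le> 2\<^sup>2" by (rule power2_le_iff_abs_le[THEN iffD2, rotated]) simp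
    then show "\<bar>u\<^sup>2 / 8 + 1/2\<bar> \<le> 1" by simp
  qed (auto simp: state_space_def)
  also have "\<dots> = x * \<bar>x\<bar> / 2 ^ Suc (Suc n)"
    using Suc by simp
  finally show ?case .
qed

lemma Pn_one:
  assumes "x \<in> state_space" and "n \<ge> 1"
  shows "Pn M \<theta> n (\<lambda>_. 1) x = \<bar>x\<bar> / 2 ^ n"
  using assms expectation_weight[of x "n - 1"] by (simp add: Pn_eq_weight)

lemma Pn_id:
  assumes x: "x \<in> state_space" and "n \<ge> 1"
  shows "Pn M \<theta> n (\<lambda>u. u) x = x * \<bar>x\<bar> / 2 ^ Suc n"
proof -
  obtain m where n: "n = Suc m"
    using \<open>n \<ge> 1\<close> by (cases n) auto
  \<comment> \<open>The weight stops at time \<open>m\<close>, so the last sign enters only through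
    the unweighted position and its coefficient is 1.\<close>
  have "Pn M \<theta> n (\<lambda>u. u) x = expectation (\<lambda>\<omega>. weight \<theta> x (Suc m) \<omega> *
      (\<theta> (Suc m) \<omega> * 1 + chain \<theta> x m \<omega> / 2))"
    by (simp add: Pn_eq_weight n add.commute)
  also have "\<dots> = expectation (\<lambda>\<omega>. weight \<theta> x (Suc m) \<omega> * (chain \<theta> x m \<omega> / 2))"
    by (rule integrate_out_sign[OF x, where g="\<lambda>_. 1" and h="\<lambda>u. u / 2" and B=1 and C=1])
      (auto simp: state_space_def)
  also have "\<dots> = x * \<bar>x\<bar> / 2 ^ Suc n"
    using expectation_weight_chain[OF x, of m] by (simp add: n)
  finally show ?thesis .
qed

section \<open>From the functional \<open>Pn\<close> to the measures\<close>

lemma deltaP_eq: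
  assumes x: "x \<in> state_space"
  shows "deltaP M \<theta> n x =
    restrict_space (distr (density M (weight \<theta> x n)) borel (chain \<theta> x n)) state_space"
    (is "_ = ?R")
proof -
  have sets_R: "sets ?R = sets (restrict_space borel state_space)"
    by (rule sets_restrict_space_cong) simp
  have space_R: "space ?R = state_space"
    by (simp add: space_restrict_space)
  \<comment> \<open>\<open>measure_of\<close> reproduces a set function only if it is a measure on
    the given sets. Matching it with a restricted push-forward settles this; the restriction
    discards the null set where the chain leaves the state space.\<close>
  have "emeasure ?R A = ennreal (Pn M \<theta> n (indicator A) x)"
    if "A \<in> sets (restrict_space borel state_space)" for A
  proof -
    have A_sub: "A \<subseteq> state_space" and A [measurable]: "A \<in> sets borel"
      using that by (auto simp: sets_restrict_space_iff)
    have "emeasure ?R A = emeasure (density M (weight \<theta> x n)) (chain \<theta> x n -` A \<inter> space M)"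
      using A_sub by (simp add: emeasure_restrict_space emeasure_distr)
    also have "\<dots> = (\<integral>\<^sup>+\<omega>. ennreal (weight \<theta> x n \<omega> * indicator A (chain \<theta> x n \<omega>)) \<partial>M)"
      by (subst emeasure_density) (auto intro!: nn_integral_cong simp: indicator_def)
    also have "\<dots> = ennreal (Pn M \<theta> n (indicator A) x)"
      unfolding Pn_eq_weight
      by (intro nn_integral_eq_integral integrable_weight[OF x, where B=1])
        (auto simp: weight_nonneg indicator_def)
    finally show ?thesis .
  qed
  then have "deltaP M \<theta> n x = measure_of (space ?R) (sets ?R) (emeasure ?R)"
    unfolding deltaP_def sets_R space_R
    using sets.sigma_sets_eq[of "restrict_space borel state_space"]
      sets.space_closed[of "restrict_space borel state_space"]
    by (intro measure_of_eq) (simp_all add: space_restrict_space)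
  then show ?thesis
    by (simp only: measure_of_of_measure)
qed

lemma has_bochner_integral_deltaP:
  assumes x: "x \<in> state_space" and g [measurable]: "g \<in> borel_measurable borel"
    and bound: "\<And>u. u \<in> state_space \<Longrightarrow> \<bar>g u\<bar> \<le> B"
  shows "has_bochner_integral (deltaP M \<theta> n x) g (Pn M \<theta> n g x)"
proof -
  have "has_bochner_integral M (\<lambda>\<omega>. weight \<theta> x n \<omega> * g (chain \<theta> x n \<omega>)) (Pn M \<theta> n g x)"
    unfolding Pn_eq_weight by (intro has_bochner_integral_integrable integrable_weight[OF x g bound])
  \<comment> \<open>Integrals over a restricted space carry the indicator of that space; almost
    surely it equals 1 along the chain.\<close>
  moreover have "AE \<omega> in M. weight \<theta> x n \<omega> * g (chain \<theta> x n \<omega>)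
      = weight \<theta> x n \<omega> *\<^sub>R (indicator state_space (chain \<theta> x n \<omega>) *\<^sub>R g (chain \<theta> x n \<omega>))"
    using AE_chain[OF x] by eventually_elim simp
  ultimately have "has_bochner_integral M (\<lambda>\<omega>. weight \<theta> x n \<omega> *\<^sub>R
      (indicator state_space (chain \<theta> x n \<omega>) *\<^sub>R g (chain \<theta> x n \<omega>))) (Pn M \<theta> n g x)"
    by (subst (asm) has_bochner_integral_cong_AE) auto
  then have "has_bochner_integral (density M (weight \<theta> x n))
      (\<lambda>\<omega>. indicator state_space (chain \<theta> x n \<omega>) *\<^sub>R g (chain \<theta> x n \<omega>)) (Pn M \<theta> n g x)"
    by (intro has_bochner_integral_density) (auto simp: weight_nonneg)
  then show ?thesis
    unfolding deltaP_eq[OF x]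
    by (subst has_bochner_integral_restrict_space) (auto intro!: has_bochner_integral_distr)
qed

lemma has_bochner_integral_normalized_deltaP:
  assumes x: "x \<in> state_space" and n: "n \<ge> 1"
  shows "has_bochner_integral (normalized_deltaP M \<theta> n x) (\<lambda>u. u) (x / 2)"
proof -
  let ?c = "1 / Pn M \<theta> n (\<lambda>_. 1) x"
  have "has_bochner_integral (deltaP M \<theta> n x) (\<lambda>u. u) (Pn M \<theta> n (\<lambda>u. u) x)"
    by (rule has_bochner_integral_deltaP[OF x, where B=2]) (auto simp: state_space_def)
  then have "has_bochner_integral (deltaP M \<theta> n x) (\<lambda>u. ?c *\<^sub>R u) (?c *\<^sub>R Pn M \<theta> n (\<lambda>u. u) x)"
    by (rule has_bochner_integral_scaleR_right)
  \<comment> \<open>Dividing x|x|/2^(n+1) by |x|/2^n uses that 0 is excluded from the state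
    space.\<close>
  also have "?c *\<^sub>R Pn M \<theta> n (\<lambda>u. u) x = x / 2"
    using x by (simp add: Pn_one[OF x n] Pn_id[OF x n] state_space_def)
  finally have "has_bochner_integral (deltaP M \<theta> n x) (\<lambda>u. ?c *\<^sub>R u) (x / 2)" .
  moreover have "0 \<le> ?c"
    by (simp add: Pn_one[OF x n])
  moreover have "(\<lambda>u. u) \<in> borel_measurable (deltaP M \<theta> n x)"
    by (simp add: deltaP_eq[OF x] measurable_restrict_space1)
  ultimately show ?thesis
    unfolding normalized_deltaP_def scale_measure_eq_density
    by (intro has_bochner_integral_density) auto
qed

end

theorem proposition3p9:
  fixes M :: "'w measure" and \<theta> :: "nat \<Rightarrow> 'w \<Rightarrow> real"
  assumes "prob_space M"
    and "prob_space.indep_vars M (\<lambda>_. borel) \<theta> {1..}"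
    and "\<And>k. k \<ge> 1 \<Longrightarrow> measure M {\<omega> \<in> space M. \<theta> k \<omega> = 1} = 1/2"
    and "\<And>k. k \<ge> 1 \<Longrightarrow> measure M {\<omega> \<in> space M. \<theta> k \<omega> = -1} = 1/2"
  shows "\<forall>x\<in>state_space. \<forall>y\<in>state_space. \<forall>n\<ge>1.
    wasserstein (\<lambda>u v. \<bar>u - v\<bar>) (normalized_deltaP M \<theta> n x) (normalized_deltaP M \<theta> n y)
      \<ge> ennreal (1/2 * \<bar>x - y\<bar>)"
proof (intro ballI allI impI)
  fix x y :: real and n :: nat
  assume x: "x \<in> state_space" and y: "y \<in> state_space" and n: "n \<ge> 1"
  interpret fair_signs M \<theta>
    using assms by (simp add: fair_signs_def fair_signs_axioms_def)
  \<comment> \<open>The means x/2 and y/2 do not depend on \<open>n\<close>, hence neither does the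
    bound.\<close>
  have "ennreal \<bar>x / 2 - y / 2\<bar>
      \<le> wasserstein (\<lambda>u v. \<bar>u - v\<bar>) (normalized_deltaP M \<theta> n x) (normalized_deltaP M \<theta> n y)"
    using wasserstein_ge_mean_diff[of "normalized_deltaP M \<theta> n x" "normalized_deltaP M \<theta> n y"]
      has_bochner_integral_normalized_deltaP[OF x n] has_bochner_integral_normalized_deltaP[OF y n]
    by (simp only: has_bochner_integral_iff)
  moreover have "\<bar>x / 2 - y / 2\<bar> = 1/2 * \<bar>x - y\<bar>"
    by (simp add: abs_if field_simps)
  ultimately show "ennreal (1/2 * \<bar>x - y\<bar>)
      \<le> wasserstein (\<lambda>u v. \<bar>u - v\<bar>) (normalized_deltaP M \<theta> n x) (normalized_deltaP M \<theta> n y)"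
    by simp
qed

end
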